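(* Let $\mathbf{p}=(\mathbf{p}_1,\dots,\mathbf{p}_n)$ be points in $(\mathbb{R}\setminus\{0\})^2$ with $\mathbf{p}_i=(a_i,b_i)$, and let $t_i=b_i/a_i$ for $i=1,\dots,n$. Then $\mathcal{H}_2(\mathbf{p})=\mathcal{P}_2(t_1,\dots,t_n)$. In particular, $\mathcal{H}_2(n)=\mathcal{P}_2(n)$.
   Context: For vectors $\mathbf{p}_1,\dots,\mathbf{p}_n\in\mathbb{R}^d$, the hyperconnectivity matrix $H(\mathbf{p})$ has rows indexed by $\{i,j\}\in\binom{[n]}{2}$ ($i<j$) and $nd$ columns in $n$ blocks of size $d$; row $\{i,j\}$ has $\mathbf{p}_j$ in block $i$, $-\mathbf{p}_i$ in block $j$, zeros elsewhere; $\mathcal{H}_d(\mathbf{p})$ is its row matroid on $\binom{[n]}{2}$. Let $\mathbb{R}[t]_{<d}$ be the space of real univariate polynomials of degree less than $d$. For reals $t_1,\dots,t_n$ and a choice of bases $F^i=(f^i_1,\dots,f^i_d)$ of $\mathbb{R}[t]_{<d}$ ($i=1,\dots,n$), the polynomial rigidity matrix has the same row/column indexing, and row $\{i,j\}$ has $F^i(t_j)=(f^i_1(t_j),\dots,f^i_d(t_j))$ in block $i$ and $-F^j(t_i)$ in block $j$, zeros elsewhere. Its row matroid does not depend on the choice of bases and is denoted $\mathcal{P}_d(t_1,\dots,t_n)$ (polynomial rigidity matroid of degree $d-1$). $\mathcal{H}_d(n)$ denotes $\mathcal{H}_d(\mathbf{p})$ for a sufficiently generic $\mathbf{p}\in(\mathbb{R}^d)^n$,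 and $\mathcal{P}_d(n)$ denotes $\mathcal{P}_d(t_1,\dots,t_n)$ for a sufficiently generic $(t_1,\dots,t_n)\in\mathbb{R}^n$. *)

theory Defs
  imports "HOL-Analysis.Analysis" "HOL-Computational_Algebra.Polynomial"
begin

text \<open>
  The index set \<open>[n]\<close> is a finite linearly ordered type \<open>'n\<close> and the dimension \<open>d\<close> is a
  finite type \<open>'d\<close>, so that the column space of the rigidity matrices, consisting of \<open>n\<close> blocks
  of size \<open>d\<close>, is \<^typ>\<open>real^'d^'n\<close>. A matrix is given by its family of rows. A matroid is the
  pair of its ground set and its collection of independent sets.
\<close>

text \<open>
  The rows of a matrix are an indexed family, which may contain repetitions; hence injectivity
  is part of independence.
\<close>

definition row_matroid :: "'e set \<Rightarrow> ('e \<Rightarrow> 'v::real_vector) \<Rightarrow> 'e set \<times> 'e set set" where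
  "row_matroid E r = (E, {S. S \<subseteq> E \<and> inj_on r S \<and> independent (r ` S)})"

definition two_subsets :: "'n set set" where
  "two_subsets = {e. card e = 2}"

definition hyperconnectivity_matrix ::
    "real^'d^'n::{finite,linorder} \<Rightarrow> 'n set \<Rightarrow> real^'d^'n::{finite,linorder}" where
  "hyperconnectivity_matrix p e =
     (let i = Min e; j = Max e
      in \<chi> k. if k = i then p $ j else if k = j then - (p $ i) else 0)"

definition hyperconnectivity_matroid ::
    "real^'d^'n::{finite,linorder} \<Rightarrow> 'n set set \<times> 'n set set set" where
  "hyperconnectivity_matroid p = row_matroid two_subsets (hyperconnectivity_matrix p)"

global_interpretation real_poly: vector_space "smult :: real \<Rightarrow> real poly \<Rightarrow> real poly"
  by unfold_locales (simp_all add: smult_add_left smult_add_right)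

definition polynomial_basis :: "('d::finite \<Rightarrow> real poly) \<Rightarrow> bool" where
  "polynomial_basis f \<longleftrightarrow>
     inj f \<and> real_poly.independent (range f) \<and>
     real_poly.span (range f) = {q. degree q < CARD('d)}"

definition polynomial_rigidity_matrix ::
    "('n \<Rightarrow> 'd \<Rightarrow> real poly) \<Rightarrow> real^'n::{finite,linorder} \<Rightarrow> 'n set \<Rightarrow> real^'d^'n::{finite,linorder}" where
  "polynomial_rigidity_matrix F t e =
     (let i = Min e; j = Max e
      in \<chi> k. if k = i then (\<chi> c. poly (F i c) (t $ j))
             else if k = j then - (\<chi> c. poly (F j c) (t $ i)) else 0)"

text \<open>
  The common row matroid for all choices of bases; lemma \<open>polynomial_rigidity_matroid_eq\<close>
  below shows that it is well defined.
\<close>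

definition polynomial_rigidity_matroid ::
    "'d::finite itself \<Rightarrow> real^'n::{finite,linorder} \<Rightarrow> 'n set set \<times> 'n set set set" where
  "polynomial_rigidity_matroid _ t =
     (THE M. \<forall>F :: 'n \<Rightarrow> 'd \<Rightarrow> real poly. (\<forall>i. polynomial_basis (F i)) \<longrightarrow>
        M = row_matroid two_subsets (polynomial_rigidity_matrix F t))"

text \<open>
  A function has generic value \<open>m\<close> if it takes the value \<open>m\<close> on some nonempty Zariski open set,
  i.e.\ wherever some polynomial that is not identically zero does not vanish. Such a value is
  unique (lemma \<open>generic_value_eq\<close>), and it exists for the two families of matroids
  (lemmas \<open>generic_hyperconnectivity_matroid\<close> and \<open>generic_polynomial_rigidity_matroid\<close>).
\<close>

definition has_generic_value :: "('a::euclidean_space \<Rightarrow> 'm) \<Rightarrow> 'm \<Rightarrow> bool" where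
  "has_generic_value f m \<longleftrightarrow>
     (\<exists>g. real_polynomial_function g \<and> (\<exists>x. g x \<noteq> 0) \<and> (\<forall>x. g x \<noteq> 0 \<longrightarrow> f x = m))"

definition generic_value :: "('a::euclidean_space \<Rightarrow> 'm) \<Rightarrow> 'm" where
  "generic_value f = (THE m. has_generic_value f m)"

definition generic_hyperconnectivity_matroid ::
    "'d::finite itself \<Rightarrow> 'n::{finite,linorder} itself \<Rightarrow> 'n set set \<times> 'n set set set" where
  "generic_hyperconnectivity_matroid _ _ =
     generic_value (\<lambda>p :: real^'d^'n::{finite,linorder}. hyperconnectivity_matroid p)"

definition generic_polynomial_rigidity_matroid ::
    "'d::finite itself \<Rightarrow> 'n::{finite,linorder} itself \<Rightarrow> 'n set set \<times> 'n set set set" where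
  "generic_polynomial_rigidity_matroid D _ =
     generic_value (\<lambda>t :: real^'n::{finite,linorder}. polynomial_rigidity_matroid D t)"


subsection \<open>Well-definedness of the polynomial rigidity matroid\<close>

lemma independent_family_iff:
  assumes "finite S"
  shows "inj_on r S \<and> independent (r ` S) \<longleftrightarrow>
    (\<forall>c. (\<Sum>e\<in>S. c e *\<^sub>R r e) = 0 \<longrightarrow> (\<forall>e\<in>S. c e = (0::real)))"
  (is "?L \<longleftrightarrow> ?R")
proof
  assume L: ?L
  show ?R
  proof (intro allI impI ballI)
    fix c e assume c: "(\<Sum>e\<in>S. c e *\<^sub>R r e) = 0" and e: "e \<in> S"
    define u where "u v = c (the_inv_into S r v)" for v
    have u: "u (r e) = c e" if "e \<in> S" for e
      using L that by (simp add: u_def the_inv_into_f_f)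
    have "(\<Sum>v\<in>r ` S. u v *\<^sub>R v) = (\<Sum>e\<in>S. c e *\<^sub>R r e)"
      using L by (subst sum.reindex) (auto simp: u intro!: sum.cong)
    with c have "(\<Sum>v\<in>r ` S. u v *\<^sub>R v) = 0" by simp
    moreover have "independent (r ` S)" using L by blast
    ultimately have "\<forall>v\<in>r ` S. u v = 0"
      using assms dependent_finite[of "r ` S"] by auto
    thus "c e = 0" using u e by auto
  qed
next
  assume R: ?R
  have inj: "inj_on r S"
  proof (rule inj_onI, rule ccontr)
    fix x y assume xy: "x \<in> S" "y \<in> S" "r x = r y" "x \<noteq> y"
    define c :: "_ \<Rightarrow> real" where "c e = (if e = x then 1 else 0) - (if e = y then 1 else 0)" for e
    have "(\<Sum>e\<in>S. c e *\<^sub>R r e) =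
       (\<Sum>e\<in>S. (if e = x then r e else 0)) - (\<Sum>e\<in>S. (if e = y then r e else 0))"
      unfolding sum_subtractf[symmetric] by (rule sum.cong) (auto simp: c_def)
    also have "\<dots> = 0" using xy assms by simp
    finally have "c x = 0" using R xy by blast
    thus False using xy by (simp add: c_def)
  qed
  moreover have "independent (r ` S)"
  proof
    assume "dependent (r ` S)"
    then obtain u v where u: "(\<Sum>v\<in>r ` S. u v *\<^sub>R v) = 0" and v: "v \<in> r ` S" "u v \<noteq> 0"
      using assms dependent_finite[of "r ` S"] by auto
    have "(\<Sum>e\<in>S. u (r e) *\<^sub>R r e) = 0"
      using u inj by (simp add: sum.reindex)
    hence "\<forall>e\<in>S. u (r e) = 0" using R by (elim allE[of _ "\<lambda>e. u (r e)"]) simp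
    with v show False by auto
  qed
  ultimately show ?L by blast
qed

lemma independent_family_linear:
  assumes "finite S" "linear L" "\<And>e. e \<in> S \<Longrightarrow> r' e = L (r e)"
    and "inj_on r' S \<and> independent (r' ` S)"
  shows "inj_on r S \<and> independent (r ` S)"
  unfolding independent_family_iff[OF assms(1)]
proof (intro allI impI)
  fix c assume "(\<Sum>e\<in>S. c e *\<^sub>R r e) = 0"
  hence "L (\<Sum>e\<in>S. c e *\<^sub>R r e) = 0" using assms(2) by (simp add: linear_0)
  hence "(\<Sum>e\<in>S. c e *\<^sub>R r' e) = 0"
    using assms(2,3) by (simp add: linear_sum linear_scale)
  thus "\<forall>e\<in>S. c e = 0"
    using assms(4) unfolding independent_family_iff[OF assms(1)] by blast
qed

lemma polynomial_basis_change:
  fixes f g :: "'d::finite \<Rightarrow> real poly"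
  assumes "polynomial_basis f" "polynomial_basis g"
  obtains A :: "'d \<Rightarrow> 'd \<Rightarrow> real" where "\<And>c. f c = (\<Sum>b\<in>UNIV. smult (A c b) (g b))"
proof -
  have "\<exists>a. f c = (\<Sum>b\<in>UNIV. smult (a b) (g b))" for c
  proof -
    have "f c \<in> real_poly.span (range g)"
      using assms real_poly.span_base[of "f c" "range f"] by (auto simp: polynomial_basis_def)
    then obtain u where "f c = (\<Sum>v\<in>range g. smult (u v) v)"
      by (auto simp: real_poly.span_finite)
    also have "\<dots> = (\<Sum>b\<in>UNIV. smult (u (g b)) (g b))"
      using assms(2) by (simp add: polynomial_basis_def sum.reindex)
    finally show ?thesis by (intro exI[of _ "\<lambda>b. u (g b)"])
  qed
  thus ?thesis using that by metis
qed

lemma polynomial_rigidity_independent_mono: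
  fixes F G :: "'n::{finite,linorder} \<Rightarrow> 'd::finite \<Rightarrow> real poly"
  assumes "\<And>i. polynomial_basis (F i)" "\<And>i. polynomial_basis (G i)"
    and "inj_on (polynomial_rigidity_matrix F t) S \<and>
      independent (polynomial_rigidity_matrix F t ` S)"
  shows "inj_on (polynomial_rigidity_matrix G t) S \<and>
      independent (polynomial_rigidity_matrix G t ` S)"
proof -
  have "\<exists>A. \<forall>c. F i c = (\<Sum>b\<in>UNIV. smult (A c b) (G i b))" for i
    using polynomial_basis_change[OF assms(1,2)] by metis
  then obtain A where A: "\<And>i c. F i c = (\<Sum>b\<in>UNIV. smult (A i c b) (G i b))" by metis
  define L :: "real^'d^'n::{finite,linorder} \<Rightarrow> real^'d^'n::{finite,linorder}"
    where "L v = (\<chi> k c. \<Sum>b\<in>UNIV. A k c b * v $ k $ b)" for v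
  have "linear L"
    by (rule linearI)
       (auto simp: L_def vec_eq_iff algebra_simps sum.distrib sum_distrib_left)
  moreover have "polynomial_rigidity_matrix F t e = L (polynomial_rigidity_matrix G t e)" for e
    by (auto simp: L_def polynomial_rigidity_matrix_def Let_def vec_eq_iff A poly_sum
        sum_negf)
  moreover have "finite S" by simp
  ultimately show ?thesis by (intro independent_family_linear[OF _ _ _ assms(3)])
qed

lemma polynomial_basis_exists: "\<exists>f :: 'd::finite \<Rightarrow> real poly. polynomial_basis f"
proof -
  obtain h :: "'d \<Rightarrow> nat" where h: "bij_betw h UNIV {..<CARD('d)}"
    using ex_bij_betw_finite_nat[of "UNIV :: 'd set"] by (auto simp: atLeast0LessThan)
  define f :: "'d \<Rightarrow> real poly" where "f c = monom 1 (h c)" for c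
  have injh: "inj h" using h by (simp add: bij_betw_def)
  have hlt: "h c < CARD('d)" for c using h by (auto simp: bij_betw_def)
  have inj: "inj f" using injh by (auto simp: f_def inj_def monom_eq_iff')
  have cf: "coeff (\<Sum>c\<in>UNIV. smult (u c) (f c)) (h c') = u c'" for u c'
  proof -
    have "coeff (\<Sum>c\<in>UNIV. smult (u c) (f c)) (h c') = (\<Sum>c\<in>UNIV. if c = c' then u c else 0)"
      unfolding coeff_sum using injh by (intro sum.cong) (auto simp: f_def inj_def)
    thus ?thesis by simp
  qed
  have "real_poly.independent (range f)"
  proof
    assume "real_poly.dependent (range f)"
    then obtain u v where u: "(\<Sum>v\<in>range f. smult (u v) v) = 0" and v: "v \<in> range f" "u v \<noteq> 0"
      using real_poly.dependent_finite[of "range f"] by auto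
    have "(\<Sum>c\<in>UNIV. smult (u (f c)) (f c)) = 0"
      using u inj by (simp add: sum.reindex)
    with cf[of "\<lambda>c. u (f c)"] have "u (f c) = 0" for c by simp
    with v show False by auto
  qed
  moreover have "real_poly.span (range f) = {q. degree q < CARD('d)}"
  proof (intro equalityI subsetI)
    fix q assume "q \<in> real_poly.span (range f)"
    then obtain u where u: "q = (\<Sum>v\<in>range f. smult (u v) v)"
      by (auto simp: real_poly.span_finite)
    have "degree q \<le> CARD('d) - 1"
      unfolding u
    proof (rule degree_sum_le)
      fix v assume "v \<in> range f"
      then obtain c where "v = f c" by auto
      moreover have "degree (f c) = h c" by (simp add: f_def degree_monom_eq)
      ultimately show "degree (smult (u v) v) \<le> CARD('d) - 1"
        using hlt[of c] degree_smult_le[of "u v" v] by simp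
    qed simp
    thus "q \<in> {q. degree q < CARD('d)}"
      using zero_less_card_finite[where 'a='d] by (simp del: zero_less_card_finite)
  next
    fix q :: "real poly" assume "q \<in> {q. degree q < CARD('d)}"
    hence deg: "degree q < CARD('d)" by simp
    have "q = (\<Sum>c\<in>UNIV. smult (coeff q (h c)) (f c))"
    proof (rule poly_eqI)
      fix n
      show "coeff q n = coeff (\<Sum>c\<in>UNIV. smult (coeff q (h c)) (f c)) n"
      proof (cases "n < CARD('d)")
        case True
        hence "n \<in> range h" using h by (simp add: bij_betw_def)
        then obtain c where "n = h c" by blast
        thus ?thesis using cf[of "\<lambda>c. coeff q (h c)" c] by simp
      next
        case False
        have "n \<noteq> h c" for c using False hlt[of c] by auto
        hence "coeff (\<Sum>c\<in>UNIV. smult (coeff q (h c)) (f c)) n = 0"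
          unfolding coeff_sum by (intro sum.neutral) (auto simp: f_def)
        moreover have "coeff q n = 0" using False deg by (intro coeff_eq_0) simp
        ultimately show ?thesis by simp
      qed
    qed
    also have "\<dots> \<in> real_poly.span (range f)"
      by (intro real_poly.span_sum real_poly.span_scale real_poly.span_base) auto
    finally show "q \<in> real_poly.span (range f)" .
  qed
  ultimately show ?thesis using inj by (auto simp: polynomial_basis_def)
qed

lemma polynomial_rigidity_matroid_eq:
  fixes F :: "'n::{finite,linorder} \<Rightarrow> 'd::finite \<Rightarrow> real poly"
  assumes "\<And>i. polynomial_basis (F i)"
  shows "polynomial_rigidity_matroid TYPE('d) t =
    row_matroid two_subsets (polynomial_rigidity_matrix F t)"
  unfolding polynomial_rigidity_matroid_def
proof (rule the_equality)
  show "\<forall>G :: 'n \<Rightarrow> 'd \<Rightarrow> real poly. (\<forall>i. polynomial_basis (G i)) \<longrightarrow>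
      row_matroid two_subsets (polynomial_rigidity_matrix F t) =
      row_matroid two_subsets (polynomial_rigidity_matrix G t)"
  proof (intro allI impI)
    fix G :: "'n \<Rightarrow> 'd \<Rightarrow> real poly" assume G: "\<forall>i. polynomial_basis (G i)"
    have "inj_on (polynomial_rigidity_matrix F t) S \<and>
        independent (polynomial_rigidity_matrix F t ` S) \<longleftrightarrow>
        inj_on (polynomial_rigidity_matrix G t) S \<and>
        independent (polynomial_rigidity_matrix G t ` S)" for S
      using polynomial_rigidity_independent_mono[of F G t S]
        polynomial_rigidity_independent_mono[of G F t S] assms G by blast
    thus "row_matroid two_subsets (polynomial_rigidity_matrix F t) =
      row_matroid two_subsets (polynomial_rigidity_matrix G t)"
      by (simp add: row_matroid_def)
  qed
qed (use assms in blast)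


subsection \<open>Well-definedness of the generic matroids\<close>

lemma real_polynomial_function_mult_nonzero:
  fixes g h :: "'a::euclidean_space \<Rightarrow> real"
  assumes g: "real_polynomial_function g" "g x \<noteq> 0"
    and h: "real_polynomial_function h" "h y \<noteq> 0"
  shows "\<exists>z. g z * h z \<noteq> 0"
proof -
  define l where "l s = x + s *\<^sub>R (y - x)" for s :: real
  have l: "polynomial_function l"
    unfolding l_def
    by (intro polynomial_function_add polynomial_function_const
        polynomial_function_bounded_linear bounded_linear_scaleR_left)
  have fin: "finite {s. k (l s) = 0}"
    if k: "real_polynomial_function k" and s0: "k (l s0) \<noteq> 0" for k s0
  proof -
    have "real_polynomial_function (k \<circ> l)" using k l by blast
    then obtain a n where an: "(k \<circ> l) = (\<lambda>s. \<Sum>i\<le>n. a i * s ^ i)"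
      using real_polynomial_function_iff_sum by metis
    define q where "q = (\<Sum>i\<le>n. monom (a i) i)"
    have q: "k (l s) = poly q s" for s
      using fun_cong[OF an, of s] by (simp add: q_def poly_sum poly_monom)
    have "q \<noteq> 0" using s0 q[of s0] by auto
    thus ?thesis by (simp add: q poly_roots_finite)
  qed
  have "finite {s. g (l s) = 0}" by (rule fin[of g 0]) (use g in \<open>auto simp: l_def\<close>)
  moreover have "finite {s. h (l s) = 0}" by (rule fin[of h 1]) (use h in \<open>auto simp: l_def\<close>)
  ultimately have "finite ({s. g (l s) = 0} \<union> {s. h (l s) = 0})" by simp
  then obtain s where "s \<notin> {s. g (l s) = 0} \<union> {s. h (l s) = 0}"
    using ex_new_if_finite[OF infinite_UNIV_char_0] by blast
  thus ?thesis by auto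
qed

lemma real_polynomial_function_prod_nonzero:
  fixes D :: "'i \<Rightarrow> 'a::euclidean_space \<Rightarrow> real"
  assumes "finite I" "\<And>i. i \<in> I \<Longrightarrow> real_polynomial_function (D i)"
    "\<And>i. i \<in> I \<Longrightarrow> \<exists>x. D i x \<noteq> 0"
  shows "\<exists>x. (\<Prod>i\<in>I. D i x) \<noteq> 0"
  using assms
proof (induction I rule: finite_induct)
  case (insert i I)
  obtain x where x: "(\<Prod>i\<in>I. D i x) \<noteq> 0" using insert by auto
  obtain y where y: "D i y \<noteq> 0" using insert by blast
  have "\<exists>z. D i z * (\<Prod>i\<in>I. D i z) \<noteq> 0"
    by (rule real_polynomial_function_mult_nonzero[where x = y and y = x])
       (use x y insert in auto)
  thus ?case using insert by simp
qed simp

lemma has_generic_value_unique: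
  assumes "has_generic_value f m" "has_generic_value f m'"
  shows "m = m'"
proof -
  obtain g x where g: "real_polynomial_function g" "g x \<noteq> 0" "\<And>x. g x \<noteq> 0 \<Longrightarrow> f x = m"
    using assms(1) by (auto simp: has_generic_value_def)
  obtain h y where h: "real_polynomial_function h" "h y \<noteq> 0" "\<And>x. h x \<noteq> 0 \<Longrightarrow> f x = m'"
    using assms(2) by (auto simp: has_generic_value_def)
  obtain z where "g z * h z \<noteq> 0"
    using real_polynomial_function_mult_nonzero[OF g(1,2) h(1,2)] by blast
  with g(3)[of z] h(3)[of z] show ?thesis by auto
qed

lemma generic_value_eq: "has_generic_value f m \<Longrightarrow> generic_value f = m"
  unfolding generic_value_def by (blast intro: has_generic_value_unique)

lemma independence_polynomial:
  fixes R :: "'a::euclidean_space \<Rightarrow> 'e::finite \<Rightarrow> 'v::euclidean_space"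
  assumes R: "\<And>e. polynomial_function (\<lambda>x. R x e)"
  shows "\<exists>D. real_polynomial_function D \<and>
    (\<forall>x. D x \<noteq> 0 \<longleftrightarrow> inj_on (R x) S \<and> independent (R x ` S))"
proof -
  define G :: "'a \<Rightarrow> real^'e^'e" where
    "G x = (\<chi> e f. if e \<in> S \<and> f \<in> S then R x e \<bullet> R x f else if e = f then 1 else 0)" for x
  have Rc: "real_polynomial_function (\<lambda>x. R x e \<bullet> b)" if "b \<in> Basis" for e b
    using R[of e] that by (auto simp: polynomial_function_iff_Basis_inner)
  have "real_polynomial_function (\<lambda>x. \<Sum>b\<in>Basis. (R x e \<bullet> b) * (R x f \<bullet> b))" for e f
    by (intro real_polynomial_function_sum real_polynomial_function.intros(4) Rc) auto
  hence "real_polynomial_function (\<lambda>x. R x e \<bullet> R x f)" for e f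
    by (simp only: euclidean_inner[symmetric])
  hence Gc: "real_polynomial_function (\<lambda>x. G x $ e $ f)" for e f
    by (cases "e \<in> S \<and> f \<in> S") (auto simp: G_def)
  have "real_polynomial_function (\<lambda>x. det (G x))"
    unfolding det_def
    by (intro real_polynomial_function_sum real_polynomial_function.intros(4)
        real_polynomial_function.intros(2) real_polynomial_function_prod Gc finite_permutations) auto
  moreover have "det (G x) \<noteq> 0 \<longleftrightarrow> inj_on (R x) S \<and> independent (R x ` S)" for x
  proof -
    have fin: "finite S" by simp
    have GS: "(G x *v c) $ e = R x e \<bullet> (\<Sum>f\<in>S. c $ f *\<^sub>R R x f)" if "e \<in> S" for c e
    proof -
      have "(G x *v c) $ e = (\<Sum>f\<in>UNIV. if f \<in> S then c $ f * (R x e \<bullet> R x f) else 0)"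
        unfolding matrix_vector_mult_def using that
        by (auto simp: G_def intro!: sum.cong)
      also have "\<dots> = (\<Sum>f\<in>S. c $ f * (R x e \<bullet> R x f))"
        by (simp add: sum.If_cases)
      finally show ?thesis by (simp add: inner_sum_right)
    qed
    have GN: "(G x *v c) $ e = c $ e" if "e \<notin> S" for c e
    proof -
      have "(G x *v c) $ e = (\<Sum>f\<in>UNIV. (if e = f then 1 else 0) * c $ f)"
        using that by (simp add: matrix_vector_mult_def G_def)
      also have "\<dots> = (\<Sum>f\<in>UNIV. if f = e then c $ f else 0)"
        by (rule sum.cong) auto
      finally have "(G x *v c) $ e = (\<Sum>f\<in>UNIV. if f = e then c $ f else 0)" .
      thus ?thesis by simp
    qed
    have "det (G x) \<noteq> 0 \<longleftrightarrow> (\<forall>c. G x *v c = 0 \<longrightarrow> c = 0)"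
      by (simp only: invertible_det_nz[symmetric] invertible_left_inverse matrix_left_invertible_ker)
    also have "\<dots> \<longleftrightarrow> (\<forall>c. (\<Sum>e\<in>S. c e *\<^sub>R R x e) = 0 \<longrightarrow> (\<forall>e\<in>S. c e = 0))"
    proof (intro iffI allI impI)
      fix c assume L: "\<forall>c. G x *v c = 0 \<longrightarrow> c = 0" and c: "(\<Sum>e\<in>S. c e *\<^sub>R R x e) = 0"
      define c' :: "real^'e" where "c' = (\<chi> e. if e \<in> S then c e else 0)"
      have "(\<Sum>f\<in>S. c' $ f *\<^sub>R R x f) = 0"
        using c by (simp add: c'_def)
      hence "(G x *v c') $ e = 0" for e
        by (cases "e \<in> S") (simp_all add: GS GN, simp add: c'_def)
      hence "c' = 0" using L by (simp add: vec_eq_iff)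
      thus "\<forall>e\<in>S. c e = 0" by (auto simp: c'_def vec_eq_iff split: if_splits)
    next
      fix c :: "real^'e"
      assume L: "\<forall>c. (\<Sum>e\<in>S. c e *\<^sub>R R x e) = 0 \<longrightarrow> (\<forall>e\<in>S. c e = 0)" and c: "G x *v c = 0"
      define w where "w = (\<Sum>f\<in>S. c $ f *\<^sub>R R x f)"
      have "R x e \<bullet> w = 0" if "e \<in> S" for e
        using GS[OF that, of c] c by (simp add: w_def)
      hence "w \<bullet> w = 0"
        by (subst w_def) (simp add: inner_sum_left)
      hence "w = 0" by simp
      hence "\<forall>e\<in>S. c $ e = 0" using L[rule_format, of "\<lambda>e. c $ e"] by (simp add: w_def)
      moreover have "c $ e = 0" if "e \<notin> S" for e using GN[OF that, of c] c by simp
      ultimately show "c = 0" by (auto simp: vec_eq_iff)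
    qed
    finally show ?thesis using independent_family_iff[OF fin, of "R x"] by blast
  qed
  ultimately show ?thesis by blast
qed

lemma has_generic_value_row_matroid:
  fixes R :: "'a::euclidean_space \<Rightarrow> 'e::finite \<Rightarrow> 'v::euclidean_space"
  assumes R: "\<And>e. polynomial_function (\<lambda>x. R x e)"
  shows "\<exists>M. has_generic_value (\<lambda>x. row_matroid E (R x)) M"
proof -
  define D where "D S = (SOME D. real_polynomial_function D \<and>
      (\<forall>x. D x \<noteq> 0 \<longleftrightarrow> inj_on (R x) S \<and> independent (R x ` S)))" for S
  have D: "real_polynomial_function (D S)"
    "D S x \<noteq> 0 \<longleftrightarrow> inj_on (R x) S \<and> independent (R x ` S)" for S x
    using someI_ex[OF independence_polynomial[of R S, OF R]] unfolding D_def by blast+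
  define I where "I = {S. \<exists>x. D S x \<noteq> 0}"
  have fin: "finite I" by simp
  define g where "g x = (\<Prod>S\<in>I. D S x)" for x
  have "real_polynomial_function g"
    unfolding g_def by (intro real_polynomial_function_prod D fin)
  moreover have "\<exists>x. g x \<noteq> 0"
    unfolding g_def by (intro real_polynomial_function_prod_nonzero D fin) (auto simp: I_def)
  moreover have "row_matroid E (R x) = (E, {S. S \<subseteq> E \<and> S \<in> I})" if "g x \<noteq> 0" for x
  proof -
    have "D S x \<noteq> 0 \<longleftrightarrow> S \<in> I" for S
      using that by (auto simp: g_def I_def)
    thus ?thesis by (simp add: row_matroid_def D(2)[symmetric])
  qed
  ultimately show ?thesis unfolding has_generic_value_def by blast
qed

lemma polynomial_function_vec2:
  fixes f :: "'a::euclidean_space \<Rightarrow> real^'d^'n"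
  assumes "\<And>k c. real_polynomial_function (\<lambda>x. f x $ k $ c)"
  shows "polynomial_function f"
  unfolding polynomial_function_iff_Basis_inner
  using assms by (auto simp: Basis_vec_def inner_axis)

lemma real_polynomial_function_poly:
  assumes "real_polynomial_function f"
  shows "real_polynomial_function (\<lambda>x. poly q (f x))"
  unfolding poly_altdef
  using assms by (intro real_polynomial_function_sum real_polynomial_function.intros(4)
    real_polynomial_function.intros(2) real_polynomial_function_power) auto

lemma generic_hyperconnectivity_matroid:
  "has_generic_value (\<lambda>p :: real^'d^'n::{finite,linorder}. hyperconnectivity_matroid p)
     (generic_hyperconnectivity_matroid TYPE('d::finite) TYPE('n::{finite,linorder}))"
proof -
  have lin: "bounded_linear (\<lambda>p :: real^'d^'n::{finite,linorder}. p $ k $ c)" for k c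
    by (intro bounded_linear_compose[OF bounded_linear_vec_nth bounded_linear_vec_nth])
  have "polynomial_function (\<lambda>p :: real^'d^'n::{finite,linorder}. hyperconnectivity_matrix p e)" for e
  proof (rule polynomial_function_vec2)
    fix k c
    show "real_polynomial_function (\<lambda>p :: real^'d^'n::{finite,linorder}. hyperconnectivity_matrix p e $ k $ c)"
      by (cases "k = Min e"; cases "k = Max e")
         (auto simp: hyperconnectivity_matrix_def Let_def
            intro!: real_polynomial_function.intros(1)[OF lin] real_polynomial_function_minus)
  qed
  from has_generic_value_row_matroid[OF this, of two_subsets "\<lambda>e. e"] show ?thesis
    unfolding generic_hyperconnectivity_matroid_def hyperconnectivity_matroid_def
    by (elim exE) (simp only: generic_value_eq)
qed

lemma generic_polynomial_rigidity_matroid: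
  "has_generic_value (\<lambda>t :: real^'n::{finite,linorder}. polynomial_rigidity_matroid TYPE('d) t)
     (generic_polynomial_rigidity_matroid TYPE('d::finite) TYPE('n::{finite,linorder}))"
proof -
  obtain f :: "'d \<Rightarrow> real poly" where f: "polynomial_basis f"
    using polynomial_basis_exists by blast
  have lin: "real_polynomial_function (\<lambda>t :: real^'n::{finite,linorder}. t $ k)" for k
    by (intro real_polynomial_function.intros(1) bounded_linear_vec_nth)
  have "polynomial_function (\<lambda>t :: real^'n::{finite,linorder}. polynomial_rigidity_matrix (\<lambda>_. f) t e)" for e
  proof (rule polynomial_function_vec2)
    fix k c
    show "real_polynomial_function (\<lambda>t :: real^'n::{finite,linorder}. polynomial_rigidity_matrix (\<lambda>_. f) t e $ k $ c)"
      by (cases "k = Min e"; cases "k = Max e")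
         (auto simp: polynomial_rigidity_matrix_def Let_def
            intro!: real_polynomial_function_poly lin real_polynomial_function_minus)
  qed
  from has_generic_value_row_matroid[OF this, of two_subsets "\<lambda>e. e"]
  have "\<exists>M. has_generic_value (\<lambda>t :: real^'n::{finite,linorder}. polynomial_rigidity_matroid TYPE('d) t) M"
    by (simp only: polynomial_rigidity_matroid_eq[of "\<lambda>_. f", OF f])
  thus ?thesis
    unfolding generic_polynomial_rigidity_matroid_def
    by (elim exE) (simp only: generic_value_eq)
qed

end

theory Submission
  imports Defs
begin

text \<open>
  If each point is a nonzero multiple \<open>a\<^sub>i (f\<^sub>1(t\<^sub>i), \<dots>, f\<^sub>d(t\<^sub>i))\<close> of a point of the curve
  parametrised by a basis of the polynomials of degree less than \<open>d\<close>, then multiplying row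
  \<open>{i, j}\<close> of the hyperconnectivity matrix by \<open>1 / (a\<^sub>i a\<^sub>j)\<close> and the columns of block \<open>k\<close> by \<open>a\<^sub>k\<close>
  yields the polynomial rigidity matrix, and neither operation changes the row matroid. For
  \<open>d = 2\<close> and the basis \<open>(1, t)\<close> the curve is a line that meets every line through the origin
  except the vertical one, so every point with nonzero first coordinate is such a multiple. The
  generic matroids agree because the polynomial map \<open>(a, t) \<mapsto> (a\<^sub>i, a\<^sub>i t\<^sub>i)\<^sub>i\<close> has dense image, so
  some \<open>(a, t)\<close> satisfies both genericity conditions at once.
\<close>

text \<open>\<open>L\<close> carries a relation with coefficients \<open>c\<close> among the rows
  \<open>r\<close> to one with coefficients \<open>c e / w e\<close> among the rows
  \<open>r'\<close>, whose independence makes them vanish.\<close>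

lemma independent_family_scaled_linear:
  fixes w :: "'e \<Rightarrow> real"
  assumes "finite S" "linear L" "\<And>e. e \<in> S \<Longrightarrow> w e \<noteq> 0"
    and "\<And>e. e \<in> S \<Longrightarrow> r' e = w e *\<^sub>R L (r e)"
    and "inj_on r' S \<and> independent (r' ` S)"
  shows "inj_on r S \<and> independent (r ` S)"
  unfolding independent_family_iff[OF assms(1)]
proof (intro allI impI)
  fix c assume "(\<Sum>e\<in>S. c e *\<^sub>R r e) = 0"
  hence "L (\<Sum>e\<in>S. c e *\<^sub>R r e) = 0" using assms(2) by (simp add: linear_0)
  hence "(\<Sum>e\<in>S. (c e / w e) *\<^sub>R r' e) = 0"
    using assms(2,3,4) by (simp add: linear_sum linear_scale)
  hence "\<forall>e\<in>S. c e / w e = 0"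
    using assms(5) unfolding independent_family_iff[OF assms(1)]
    by (elim conjE allE[of _ "\<lambda>e. c e / w e"]) simp
  thus "\<forall>e\<in>S. c e = 0" using assms(3) by simp
qed

text \<open>\<open>L\<close> pulls independence back from \<open>r'\<close> to \<open>r\<close>, and
  \<open>L'\<close> from \<open>r\<close> to \<open>r'\<close>.\<close>

lemma row_matroid_scaled_linear_eq:
  fixes r :: "'e::finite \<Rightarrow> 'v::real_vector" and r' :: "'e \<Rightarrow> 'w::real_vector"
  assumes "linear L" "\<And>e. w e \<noteq> 0" "\<And>e. e \<in> E \<Longrightarrow> r' e = w e *\<^sub>R L (r e)"
    and "linear L'" "\<And>e. w' e \<noteq> 0" "\<And>e. e \<in> E \<Longrightarrow> r e = w' e *\<^sub>R L' (r' e)"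
  shows "row_matroid E r = row_matroid E r'"
proof -
  have "inj_on r S \<and> independent (r ` S) \<longleftrightarrow> inj_on r' S \<and> independent (r' ` S)"
    if "S \<subseteq> E" for S
  proof
    assume "inj_on r S \<and> independent (r ` S)"
    then show "inj_on r' S \<and> independent (r' ` S)"
      by (rule independent_family_scaled_linear[rotated 4, of r S L' w'])
         (use assms that in auto)
  next
    assume "inj_on r' S \<and> independent (r' ` S)"
    then show "inj_on r S \<and> independent (r ` S)"
      by (rule independent_family_scaled_linear[rotated 4, of r' S L w])
         (use assms that in auto)
  qed
  then show ?thesis unfolding row_matroid_def by blast
qed

lemma hyperconnectivity_matroid_eq_polynomial_rigidity_matroid:
  fixes p :: "real^'d^'n::{finite,linorder}" and f :: "'d::finite \<Rightarrow> real poly"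
  assumes f: "polynomial_basis f" and a: "\<And>i. a i \<noteq> 0"
    and p: "\<And>i c. p $ i $ c = a i * poly (f c) (t $ i)"
  shows "hyperconnectivity_matroid p = polynomial_rigidity_matroid TYPE('d) t"
proof -
  \<comment> \<open>In row \<open>e\<close> each of the two blocks carries the factor of the
    opposite endpoint; once block \<open>k\<close> is multiplied by \<open>a k\<close>, both carry
    the common factor \<open>w e\<close>.\<close>
  define w where "w e = a (Min e) * a (Max e)" for e
  define L :: "('n \<Rightarrow> real) \<Rightarrow> real^'d^'n::{finite,linorder} \<Rightarrow> real^'d^'n::{finite,linorder}"
    where "L u v = (\<chi> k. u k *\<^sub>R v $ k)" for u v
  have linear_L: "linear (L u)" for u
    by (rule linearI) (auto simp: L_def vec_eq_iff algebra_simps)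
  have w: "w e \<noteq> 0" for e using a by (simp add: w_def)
  have "row_matroid two_subsets (hyperconnectivity_matrix p) =
      row_matroid two_subsets (polynomial_rigidity_matrix (\<lambda>_. f) t)"
    by (rule row_matroid_scaled_linear_eq[where L = "L a" and w = "\<lambda>e. inverse (w e)"
          and L' = "L (\<lambda>k. inverse (a k))" and w' = w])
       (auto simp: linear_L w a p L_def w_def vec_eq_iff field_simps Let_def
          hyperconnectivity_matrix_def polynomial_rigidity_matrix_def)
  then show ?thesis
    using polynomial_rigidity_matroid_eq[of "\<lambda>_. f" t] f
    by (simp add: hyperconnectivity_matroid_def)
qed

text \<open>This basis traces the line \<open>(1, t)\<close>, on which the parameter is the ratio of
  the second coordinate to the first.\<close>

lemma polynomial_basis_linear:
  "polynomial_basis (\<lambda>c :: 2. if c = 1 then 1 else [:0, 1:])"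
proof -
  let ?f = "\<lambda>c :: 2. if c = 1 then 1 else [:0, 1 :: real:]"
  have one: "(1 :: real poly) = [:1:]" by (simp add: one_pCons)
  have rng: "range ?f = {1, [:0, 1:]}" by (auto simp: UNIV_2)
  have "inj ?f" unfolding inj_def forall_2 by (simp add: one)
  moreover have "real_poly.independent (range ?f)"
    unfolding rng
    by (auto simp: real_poly.independent_insert real_poly.span_insert one)
  moreover have "real_poly.span (range ?f) = {q. degree q < CARD(2)}"
  proof (intro set_eqI iffI)
    fix q assume "q \<in> real_poly.span (range ?f)"
    then obtain u v where "q = [:u, v:]"
      unfolding rng by (auto simp: real_poly.span_insert one algebra_simps eq_diff_eq)
    then show "q \<in> {q. degree q < CARD(2)}" by simp
  next
    fix q :: "real poly" assume "q \<in> {q. degree q < CARD(2)}"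
    then have "coeff q n = 0" if "n > 1" for n using that by (intro coeff_eq_0) simp
    then obtain u v where "q = [:u, v:]"
      by (intro that[of "coeff q 0" "coeff q 1"] poly_eqI)
         (auto simp: coeff_pCons split: nat.split)
    then have "q = smult u 1 + smult v [:0, 1:]" by (simp add: one)
    also have "\<dots> \<in> real_poly.span (range ?f)"
      unfolding rng
      by (intro real_poly.span_add real_poly.span_scale real_poly.span_base) auto
    finally show "q \<in> real_poly.span (range ?f)" .
  qed
  ultimately show ?thesis by (simp add: polynomial_basis_def)
qed

text \<open>A point \<open>(a, b)\<close> with \<open>a\<close> nonzero is \<open>a\<close> times
  the point \<open>(1, b / a)\<close>.\<close>

lemma hyperconnectivity_matroid_plane:
  fixes p :: "real^2^'n::{finite,linorder}"
  assumes "\<And>i. p $ i $ 1 \<noteq> 0"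
  shows "hyperconnectivity_matroid p =
    polynomial_rigidity_matroid TYPE(2) (\<chi> i. p $ i $ 2 / p $ i $ 1)"
proof (rule hyperconnectivity_matroid_eq_polynomial_rigidity_matroid[OF polynomial_basis_linear])
  show "p $ i $ 1 \<noteq> 0" for i by (rule assms)
  show "p $ i $ c = p $ i $ 1 * poly (if c = 1 then 1 else [:0, 1:])
      ((\<chi> i. p $ i $ 2 / p $ i $ 1) $ i)" for i c
    using assms exhaust_2[of c] by auto
qed

lemma generic_hyperconnectivity_matroid_plane:
  "generic_hyperconnectivity_matroid TYPE(2) TYPE('n::{finite,linorder}) =
     generic_polynomial_rigidity_matroid TYPE(2) TYPE('n)"
  (is "?M = ?N")
proof -
  obtain g p0 where g: "real_polynomial_function g" "g p0 \<noteq> 0"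
    "\<And>p :: real^2^'n::{finite,linorder}. g p \<noteq> 0 \<Longrightarrow> hyperconnectivity_matroid p = ?M"
    using generic_hyperconnectivity_matroid[where 'd = 2 and 'n = 'n]
    unfolding has_generic_value_def by blast
  obtain h t0 where h: "real_polynomial_function h" "h t0 \<noteq> 0"
    "\<And>t :: real^'n::{finite,linorder}. h t \<noteq> 0 \<Longrightarrow> polynomial_rigidity_matroid TYPE(2) t = ?N"
    using generic_polynomial_rigidity_matroid[where 'd = 2 and 'n = 'n]
    unfolding has_generic_value_def by blast
  have coord: "real_polynomial_function (\<lambda>z :: real^2^'n::{finite,linorder}. z $ k $ c)" for k c
    by (intro real_polynomial_function.intros(1)
        bounded_linear_compose[OF bounded_linear_vec_nth bounded_linear_vec_nth])
  \<comment> \<open>Where \<open>d\<close> is nonzero, the planar case applies and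
    \<open>\<phi>\<close> can be inverted by division.\<close>
  define d where "d z = (\<Prod>i\<in>UNIV. z $ i $ 1)" for z :: "real^2^'n::{finite,linorder}"
  have d: "real_polynomial_function d"
    unfolding d_def by (intro real_polynomial_function_prod coord) simp
  have d_nonzero: "d z \<noteq> 0 \<longleftrightarrow> (\<forall>i. z $ i $ 1 \<noteq> 0)" for z by (simp add: d_def)
  \<comment> \<open>A vector \<open>z\<close> encodes a pair \<open>(a, t)\<close> as \<open>z\<^sub>i = (a\<^sub>i, t\<^sub>i)\<close>.\<close>
  define \<phi> :: "real^2^'n::{finite,linorder} \<Rightarrow> real^2^'n::{finite,linorder}"
    where "\<phi> z = (\<chi> i c. if c = 1 then z $ i $ 1 else z $ i $ 1 * z $ i $ 2)" for z
  define \<tau> :: "real^2^'n::{finite,linorder} \<Rightarrow> real^'n::{finite,linorder}" where "\<tau> z = (\<chi> i. z $ i $ 2)" for z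
  have "polynomial_function \<phi>"
  proof (rule polynomial_function_vec2)
    show "real_polynomial_function (\<lambda>z. \<phi> z $ k $ c)" for k c
      by (cases "c = 1") (auto simp: \<phi>_def intro!: coord real_polynomial_function.intros(4))
  qed
  with g(1) have g\<phi>: "real_polynomial_function (g \<circ> \<phi>)" by blast
  have "polynomial_function \<tau>"
    unfolding polynomial_function_iff_Basis_inner
    using coord by (auto simp: \<tau>_def Basis_vec_def inner_axis)
  with h(1) have h\<tau>: "real_polynomial_function (h \<circ> \<tau>)" by blast
  \<comment> \<open>\<open>g\<close> and \<open>d\<close> are nonzero together at some
    \<open>p\<close>; its preimage \<open>z1\<close> under \<open>\<phi>\<close> shows that the
    product of \<open>g \<circ> \<phi>\<close> and \<open>d\<close> is not identically zero.\<close>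
  have "d (\<chi> i c. 1) \<noteq> 0" by (simp add: d_nonzero)
  then obtain p where "g p * d p \<noteq> 0"
    using real_polynomial_function_mult_nonzero[OF g(1,2) d] by blast
  then have p: "g p \<noteq> 0" "\<And>i. p $ i $ 1 \<noteq> 0" by (simp_all add: d_nonzero)
  define z1 :: "real^2^'n::{finite,linorder}"
    where "z1 = (\<chi> i c. if c = 1 then p $ i $ 1 else p $ i $ 2 / p $ i $ 1)"
  have "\<phi> z1 = p"
    using p(2) by (simp add: \<phi>_def z1_def vec_eq_iff forall_2)
  moreover have "d z1 \<noteq> 0" using p(2) by (simp add: d_nonzero z1_def)
  ultimately have z1: "(g \<circ> \<phi>) z1 * d z1 \<noteq> 0" using p(1) by simp
  \<comment> \<open>\<open>\<tau>\<close> forgets first coordinates, so any vector with second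
    coordinates \<open>t0\<close> serves as a witness.\<close>
  have "(h \<circ> \<tau>) (\<chi> i c. t0 $ i) \<noteq> 0"
    using h(2) by (simp add: \<tau>_def)
  then obtain z where z: "((g \<circ> \<phi>) z * d z) * (h \<circ> \<tau>) z \<noteq> 0"
    using real_polynomial_function_mult_nonzero[OF real_polynomial_function.intros(4)[OF g\<phi> d] z1 h\<tau>]
    by blast
  then have nz: "\<And>i. z $ i $ 1 \<noteq> 0" by (simp add: d_nonzero)
  \<comment> \<open>Both matroids take their generic values, at \<open>\<phi> z\<close> and at
    \<open>\<tau> z\<close>, and the slopes of \<open>\<phi> z\<close> are the entries of
    \<open>\<tau> z\<close>.\<close>
  have "?M = hyperconnectivity_matroid (\<phi> z)" using g(3) z by simp
  also have "\<dots> = polynomial_rigidity_matroid TYPE(2) (\<chi> i. \<phi> z $ i $ 2 / \<phi> z $ i $ 1)"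
    by (rule hyperconnectivity_matroid_plane) (simp add: \<phi>_def nz)
  also have "(\<chi> i. \<phi> z $ i $ 2 / \<phi> z $ i $ 1) = \<tau> z"
    by (simp add: \<phi>_def \<tau>_def vec_eq_iff nz)
  also have "polynomial_rigidity_matroid TYPE(2) (\<tau> z) = ?N" using h(3) z by simp
  finally show ?thesis .
qed

theorem theorem2p2:
  shows "(\<forall>(p :: real^2^'n::{finite,linorder}) a b.
            (\<forall>i. p $ i = vector [a i, b i] \<and> a i \<noteq> 0 \<and> b i \<noteq> 0) \<longrightarrow>
            hyperconnectivity_matroid p =
              polynomial_rigidity_matroid TYPE(2) (\<chi> i. b i / a i)) \<and>
         generic_hyperconnectivity_matroid TYPE(2) TYPE('n) =
           generic_polynomial_rigidity_matroid TYPE(2) TYPE('n)"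
proof (intro conjI allI impI)
  fix p :: "real^2^'n::{finite,linorder}" and a b
  assume "\<forall>i. p $ i = vector [a i, b i] \<and> a i \<noteq> 0 \<and> b i \<noteq> 0"
  then have "p $ i $ 1 = a i" "p $ i $ 2 = b i" "a i \<noteq> 0" for i by simp_all
  then show "hyperconnectivity_matroid p =
      polynomial_rigidity_matroid TYPE(2) (\<chi> i. b i / a i)"
    using hyperconnectivity_matroid_plane[of p] by simp
qed (rule generic_hyperconnectivity_matroid_plane)

end
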